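(* Let $n\ge 1$ and let $G$ be a finitely generated abelian sub-semigroup of $M_n(\mathbb{C})$, generated by $A_1,\dots,A_p$ ($p\ge 1$). Let $P\in \mathrm{GL}(n,\mathbb{C})$, $r\in\{1,\dots,n\}$ and $\eta=(n_1,\dots,n_r)$ be a sequence of positive integers with $n_1+\dots+n_r=n$ such that $P^{-1}GP\subset \mathcal{K}_{\eta,r}(\mathbb{C})$. If $G$ is not hypercyclic, then there exist $G$-invariant vector subspaces $H_1,\dots,H_r$ of $\mathbb{C}^n$, each of dimension $n-1$, such that $$E:=\{x\in\mathbb{C}^n: J_G(x)=\mathbb{C}^n\}\subset\bigcup_{k=1}^{r}H_k .$$
   Context: $M_n(\mathbb{C})$ is the set of $n\times n$ complex matrices. $\mathbb{N}$ contains $0$. The abelian semigroup $G$ generated by pairwise commuting matrices $A_1,\dots,A_p$ is the set of products $A_1^{k_1}\cdots A_p^{k_p}$ with $k_j$ non-negative integers. The orbit of $v\in\mathbb{C}^n$ is $G(v)=\{Av: A\in G\}$. $G$ is hypercyclic if there exists $v\in\mathbb{C}^n$ with $G(v)$ dense in $\mathbb{C}^n$. A subset $H\subset\mathbb{C}^n$ is $G$-invariant if $A(H)\subset H$ for every $A\in G$. Extended limit set: for $x\in\mathbb{C}^n$, $J_G(x)$ is the set of $y\in\mathbb{C}^n$ for which there exist a sequence $(x_m)_m\subset\mathbb{C}^n$ and sequences of non-negative integers $(k_m^{(j)})_m$, $j=1,\dots,p$, with $k_m^{(1)}+\dots+k_m^{(p)}\to+\infty$, such that $x_m\to x$ and $A_1^{k_m^{(1)}}\cdots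 A_p^{k_m^{(p)}}x_m\to y$. $\mathbb{T}_m(\mathbb{C})$ is the set of $m\times m$ complex lower triangular matrices whose diagonal entries are all equal. For positive integers $n_1,\dots,n_r$ with sum $n$ and $\eta=(n_1,\dots,n_r)$, $\mathcal{K}_{\eta,r}(\mathbb{C})=\mathbb{T}_{n_1}(\mathbb{C})\oplus\dots\oplus\mathbb{T}_{n_r}(\mathbb{C})$ is the set of block diagonal matrices $\mathrm{diag}(B_1,\dots,B_r)$ with $B_k\in\mathbb{T}_{n_k}(\mathbb{C})$. It is a known fact that for every abelian sub-semigroup $G$ of $M_n(\mathbb{C})$ there exist such $P,\eta,r$. *)

theory Defs
  imports "HOL-Analysis.Analysis"
begin

(* Matrix powers and products are written out with the matrix product: on the type of square
   matrices the overloaded multiplication (and hence the power operator) is entrywise. *)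

definition mat_power :: "complex ^ 'n ^ 'n \<Rightarrow> nat \<Rightarrow> complex ^ 'n ^ 'n" where
  "mat_power A k = ((\<lambda>M. A ** M) ^^ k) (mat 1)"

(* A_1^(k 1) ** ... ** A_p^(k p) *)
definition mat_monomial ::
  "nat \<Rightarrow> (nat \<Rightarrow> complex ^ 'n ^ 'n) \<Rightarrow> (nat \<Rightarrow> nat) \<Rightarrow> complex ^ 'n ^ 'n" where
  "mat_monomial p A k = foldr (\<lambda>j M. mat_power (A j) (k j) ** M) [1..<Suc p] (mat 1)"

(* Exponents may vanish, so the identity always belongs to the semigroup. *)
definition gen_semigroup ::
  "nat \<Rightarrow> (nat \<Rightarrow> complex ^ 'n ^ 'n) \<Rightarrow> (complex ^ 'n ^ 'n) set" where
  "gen_semigroup p A = {mat_monomial p A k | k. True}"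

definition orbit :: "(complex ^ 'n ^ 'n) set \<Rightarrow> complex ^ 'n \<Rightarrow> (complex ^ 'n) set" where
  "orbit G v = {M *v v | M. M \<in> G}"

definition hypercyclic :: "(complex ^ 'n ^ 'n) set \<Rightarrow> bool" where
  "hypercyclic G \<longleftrightarrow> (\<exists>v. closure (orbit G v) = UNIV)"

definition invariant_under :: "(complex ^ 'n ^ 'n) set \<Rightarrow> (complex ^ 'n) set \<Rightarrow> bool" where
  "invariant_under G H \<longleftrightarrow> (\<forall>M\<in>G. (\<lambda>v. M *v v) ` H \<subseteq> H)"

(* The extended limit set J_G(x); it refers to the chosen generators, not only to the
   semigroup. *)
definition ext_limit_set ::
  "nat \<Rightarrow> (nat \<Rightarrow> complex ^ 'n ^ 'n) \<Rightarrow> complex ^ 'n \<Rightarrow> (complex ^ 'n) set" where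
  "ext_limit_set p A x =
     {y. \<exists>(X :: nat \<Rightarrow> complex ^ 'n) (k :: nat \<Rightarrow> nat \<Rightarrow> nat).
           filterlim (\<lambda>m. \<Sum>j=1..p. k m j) at_top sequentially \<and>
           X \<longlonglongrightarrow> x \<and>
           (\<lambda>m. mat_monomial p A (k m) *v X m) \<longlonglongrightarrow> y}"

(* Lower triangular m x m matrices with constant diagonal. Since m varies with the block,
   such a matrix is a function of row and column numbers, of which only the values at
   indices below m matter. *)
definition T_set :: "nat \<Rightarrow> (nat \<Rightarrow> nat \<Rightarrow> complex) set" where
  "T_set m = {B. (\<forall>i<m. \<forall>j<m. i < j \<longrightarrow> B i j = 0) \<and> (\<forall>i<m. \<forall>j<m. B i i = B j j)}"

(* The linear order on the index type numbers the coordinates 0, ..., n - 1. *)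
definition pos :: "'n::{finite,linorder} \<Rightarrow> nat" where
  "pos i = card {j. j < i}"

definition block_start :: "(nat \<Rightarrow> nat) \<Rightarrow> nat \<Rightarrow> nat" where
  "block_start \<eta> k = (\<Sum>l\<in>{1..<k}. \<eta> l)"

(* diag(B_1, ..., B_r), where B_k has size \<eta> k. Block k occupies the positions from
   block_start \<eta> k up to block_start \<eta> k + \<eta> k - 1; these ranges are disjoint, so at most one
   summand is nonzero. *)
definition block_diag ::
  "(nat \<Rightarrow> nat) \<Rightarrow> nat \<Rightarrow> (nat \<Rightarrow> nat \<Rightarrow> nat \<Rightarrow> complex)
     \<Rightarrow> complex ^ 'n::{finite,linorder} ^ 'n::{finite,linorder}" where
  "block_diag \<eta> r B = (\<chi> i j. \<Sum>k=1..r.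
     if pos i \<in> {block_start \<eta> k..<block_start \<eta> k + \<eta> k} \<and>
        pos j \<in> {block_start \<eta> k..<block_start \<eta> k + \<eta> k}
     then B k (pos i - block_start \<eta> k) (pos j - block_start \<eta> k) else 0)"

definition K_set :: "(nat \<Rightarrow> nat) \<Rightarrow> nat \<Rightarrow> (complex ^ 'n::{finite,linorder} ^ 'n::{finite,linorder}) set" where
  "K_set \<eta> r = {block_diag \<eta> r B | B. \<forall>k\<in>{1..r}. B k \<in> T_set (\<eta> k)}"

end

theory Submission
  imports Defs
begin

text \<open>
  The \<open>k\<close>-th hyperplane is the kernel of the first coordinate of block \<open>k\<close> in the basis given
  by \<open>P\<close>. These coordinate functionals are eigenvectors of every element of \<open>G\<close>, and every
  character on the diagonal is the eigenvalue of one of them. Let \<open>x\<close> lie on none of these hyperplanes, with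
  \<open>J\<^sub>G(x)\<close> the whole space.

  If the orbit of \<open>x\<close> spans a proper subspace, a row vector that annihilates it, chosen with its last
  nonzero entry as early as possible, is a common eigenvector of the triangular matrices. Its
  eigenvalues along any sequence witnessing \<open>y \<in> J\<^sub>G(x)\<close> converge, because the coordinate
  functional with the same character does not vanish at \<open>x\<close>; hence the annihilator kills \<open>y\<close> as well,
  which is absurd for a general \<open>y\<close>.

  So the orbit spans. Then \<open>z = \<Phi>(z) x\<close> for a linear family \<open>\<Phi>(z)\<close> of combinations of elements of
  \<open>G\<close>, with \<open>\<Phi>(x) = 1\<close>. Since \<open>\<Phi>(z)\<close> commutes with \<open>G\<close>, we have \<open>M x\<^sub>m = \<Phi>(x\<^sub>m) (M x)\<close>, so
  \<open>x\<^sub>m \<longlonglongrightarrow> x\<close> and \<open>M\<^sub>m x\<^sub>m \<longlonglongrightarrow> y\<close> force \<open>M\<^sub>m x \<longlonglongrightarrow> y\<close>: the orbit of \<open>x\<close> is dense.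
\<close>

section \<open>Monomials in commuting matrices\<close>

lemma mat_power_commute:
  assumes "B ** A = A ** B"
  shows "B ** mat_power A k = mat_power A k ** B"
proof (induction k)
  case 0
  show ?case by (simp add: mat_power_def)
next
  case (Suc k)
  have "B ** (A ** mat_power A k) = A ** (B ** mat_power A k)"
    by (simp add: matrix_mul_assoc assms)
  also have "\<dots> = (A ** mat_power A k) ** B"
    by (simp add: Suc matrix_mul_assoc)
  finally show ?case by (simp add: mat_power_def)
qed

text \<open>Stated for an arbitrary list of factors so that induction on the list applies; monomials
  are the case \<open>[1..<Suc p]\<close>.\<close>

lemma mat_power_product_commute:
  assumes "\<And>j. j \<in> set js \<Longrightarrow> B ** A j = A j ** B"
  shows "B ** foldr (\<lambda>j M. mat_power (A j) (k j) ** M) js (mat 1)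
    = foldr (\<lambda>j M. mat_power (A j) (k j) ** M) js (mat 1) ** B"
  using assms
proof (induction js)
  case (Cons j js)
  have "B ** mat_power (A j) (k j) = mat_power (A j) (k j) ** B"
    using Cons.prems by (intro mat_power_commute) auto
  moreover have "B ** foldr (\<lambda>j M. mat_power (A j) (k j) ** M) js (mat 1)
    = foldr (\<lambda>j M. mat_power (A j) (k j) ** M) js (mat 1) ** B"
    using Cons by simp
  ultimately show ?case
    by simp (simp add: matrix_mul_assoc flip: matrix_mul_assoc[of "mat_power (A j) (k j)" B])
qed simp

lemma mat_monomial_commute:
  assumes "\<And>j. j \<in> {1..p} \<Longrightarrow> B ** A j = A j ** B"
  shows "B ** mat_monomial p A k = mat_monomial p A k ** B"
  unfolding mat_monomial_def by (rule mat_power_product_commute) (use assms in auto)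

lemma gen_semigroup_commute:
  assumes "\<forall>i\<in>{1..p}. \<forall>j\<in>{1..p}. A i ** A j = A j ** A i"
    and "M \<in> gen_semigroup p A" "N \<in> gen_semigroup p A"
  shows "M ** N = N ** M"
proof -
  obtain k l where MN: "M = mat_monomial p A k" "N = mat_monomial p A l"
    using assms by (auto simp: gen_semigroup_def)
  have "A j ** M = M ** A j" if "j \<in> {1..p}" for j
    unfolding MN using assms(1) that by (intro mat_monomial_commute) auto
  then show ?thesis
    unfolding MN(2) by (intro mat_monomial_commute) simp
qed

lemma mat_power_add: "mat_power A (k + l) = mat_power A k ** mat_power A l"
  by (induction k) (simp_all add: mat_power_def matrix_mul_assoc)

lemma mat_monomial_add:
  assumes "\<forall>i\<in>{1..p}. \<forall>j\<in>{1..p}. A i ** A j = A j ** A i"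
  shows "mat_monomial p A (\<lambda>j. k j + l j) = mat_monomial p A k ** mat_monomial p A l"
proof -
  let ?F = "\<lambda>k js. foldr (\<lambda>j M. mat_power (A j) (k j) ** M) js (mat 1)"
  have "?F (\<lambda>j. k j + l j) js = ?F k js ** ?F l js" if "set js \<subseteq> {1..p}" for js
    using that
  proof (induction js)
    case (Cons j js)
    \<comment> \<open>The new factor of the second product has to move left past the remaining
      factors of the first.\<close>
    have "mat_power (A j) (l j) ** ?F k js = ?F k js ** mat_power (A j) (l j)"
      using Cons.prems assms
      by (intro mat_power_product_commute mat_power_commute[symmetric]) auto
    then have "mat_power (A j) (k j) ** (mat_power (A j) (l j) ** ?F k js) ** ?F l js
        = mat_power (A j) (k j) ** (?F k js ** mat_power (A j) (l j)) ** ?F l js"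
      by simp
    moreover have "?F (\<lambda>j. k j + l j) js = ?F k js ** ?F l js"
      using Cons by simp
    ultimately show ?case by (simp add: mat_power_add matrix_mul_assoc)
  qed simp
  moreover have "set [1..<Suc p] \<subseteq> {1..p}" by auto
  ultimately show ?thesis unfolding mat_monomial_def by blast
qed

lemma gen_semigroup_mult:
  assumes "\<forall>i\<in>{1..p}. \<forall>j\<in>{1..p}. A i ** A j = A j ** A i"
    and "M \<in> gen_semigroup p A" "N \<in> gen_semigroup p A"
  shows "M ** N \<in> gen_semigroup p A"
  using assms(2,3) mat_monomial_add[OF assms(1), symmetric] by (auto simp: gen_semigroup_def)

lemma mat_power_0 [simp]: "mat_power A 0 = mat 1"
  by (simp add: mat_power_def)

lemma mat_1_in_gen_semigroup: "mat 1 \<in> gen_semigroup p A"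
proof -
  have "foldr (\<lambda>j M. mat_power (A j) 0 ** M) js (mat 1) = mat 1" for js
    by (induction js) auto
  then have "mat_monomial p A (\<lambda>_. 0) = mat 1"
    unfolding mat_monomial_def .
  then show ?thesis unfolding gen_semigroup_def by (metis (mono_tags, lifting) mem_Collect_eq)
qed

section \<open>Block triangular matrices\<close>

lemma pos_less_iff: "pos i < pos j \<longleftrightarrow> i < j"
proof -
  have *: "pos i < pos j" if "i < j" for i j :: "'a::{finite,linorder}"
    unfolding pos_def using that by (intro psubset_card_mono) auto
  show ?thesis
    using *[of i j] *[of j i] by (cases i j rule: linorder_cases) auto
qed

lemma pos_inject: "pos i = pos j \<longleftrightarrow> i = j"
  using pos_less_iff[of i j] pos_less_iff[of j i] by (cases i j rule: linorder_cases) auto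

lemma pos_less_card: "pos (i :: 'n::{finite,linorder}) < CARD('n)"
  unfolding pos_def by (intro psubset_card_mono) auto

lemma range_pos: "range (pos :: 'n::{finite,linorder} \<Rightarrow> nat) = {..<CARD('n)}"
proof (rule card_subset_eq)
  show "range (pos :: 'n \<Rightarrow> nat) \<subseteq> {..<CARD('n)}"
    by (auto simp: pos_less_card)
  have "inj (pos :: 'n \<Rightarrow> nat)" by (simp add: inj_def pos_inject)
  then show "card (range (pos :: 'n \<Rightarrow> nat)) = card {..<CARD('n)}"
    by (simp add: card_image)
qed simp

text \<open>Yields disjointness of the ranges of distinct blocks; with \<open>l = Suc r\<close> it
  also bounds each block by the total size.\<close>

lemma block_start_add_le:
  assumes "1 \<le> k" "k < l"
  shows "block_start \<eta> k + \<eta> k \<le> block_start \<eta> l"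
proof -
  have "block_start \<eta> k + \<eta> k = sum \<eta> (insert k {1..<k})"
    by (simp add: block_start_def)
  also have "\<dots> \<le> sum \<eta> {1..<l}"
    using assms by (intro sum_mono2) auto
  finally show ?thesis by (simp add: block_start_def)
qed

lemma ex_block:
  assumes "m < (\<Sum>k=1..r. \<eta> k)"
  shows "\<exists>k\<in>{1..r}. m \<in> {block_start \<eta> k..<block_start \<eta> k + \<eta> k}"
  using assms
proof (induction r)
  case (Suc r)
  show ?case
  proof (cases "m < (\<Sum>k=1..r. \<eta> k)")
    case True
    then obtain k where "k \<in> {1..r}" "m \<in> {block_start \<eta> k..<block_start \<eta> k + \<eta> k}"
      using Suc.IH by blast
    then show ?thesis by (intro bexI[of _ k]) auto
  next
    case False
    moreover have "block_start \<eta> (Suc r) = (\<Sum>k=1..r. \<eta> k)"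
      by (simp add: block_start_def atLeastLessThanSuc_atLeastAtMost)
    ultimately show ?thesis using Suc.prems by (intro bexI[of _ "Suc r"]) auto
  qed
qed simp

text \<open>Since the block ranges are disjoint, row \<open>i\<close> meets only block
  \<open>k\<close>, and every other summand vanishes.\<close>

lemma block_diag_nth:
  assumes "k \<in> {1..r}" "pos i \<in> {block_start \<eta> k..<block_start \<eta> k + \<eta> k}"
  shows "block_diag \<eta> r B $ i $ j =
    (if pos j \<in> {block_start \<eta> k..<block_start \<eta> k + \<eta> k}
     then B k (pos i - block_start \<eta> k) (pos j - block_start \<eta> k) else 0)"
proof -
  have *: "pos i \<notin> {block_start \<eta> l..<block_start \<eta> l + \<eta> l}" if "l \<in> {1..r} - {k}" for l
    using block_start_add_le[of k l \<eta>] block_start_add_le[of l k \<eta>] that assms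
    by (cases l k rule: linorder_cases) simp_all
  show ?thesis
    unfolding block_diag_def vec_lambda_beta sum.remove[OF finite_atLeastAtMost assms(1)]
    using * assms(2) by (subst sum.neutral) auto
qed

section \<open>Entries of matrices in \<open>K_set\<close>\<close>

lemma K_set_lower_triangular:
  fixes M :: "complex ^ 'n::{finite,linorder} ^ 'n::{finite,linorder}"
  assumes "M \<in> K_set \<eta> r" "(\<Sum>k=1..r. \<eta> k) = CARD('n)" "i < j"
  shows "M $ i $ j = 0"
proof -
  obtain B where M: "M = block_diag \<eta> r B" and B: "\<And>k. k \<in> {1..r} \<Longrightarrow> B k \<in> T_set (\<eta> k)"
    using assms by (auto simp: K_set_def)
  obtain k where k: "k \<in> {1..r}" "pos i \<in> {block_start \<eta> k..<block_start \<eta> k + \<eta> k}"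
    using ex_block[of "pos i" \<eta> r] assms(2) pos_less_card[of i] by auto
  have "pos i < pos j" using assms by (simp add: pos_less_iff)
  then show ?thesis
    using B[OF k(1)] k unfolding M block_diag_nth[OF k] T_set_def by auto
qed

text \<open>Row \<open>s\<close> is the top row of block \<open>k\<close>: inside the block every
  other column lies to the right of the diagonal. Hence coordinate \<open>s\<close> is a common
  eigenvector among the row vectors.\<close>

lemma K_set_first_row:
  fixes M :: "complex ^ 'n::{finite,linorder} ^ 'n::{finite,linorder}"
  assumes "M \<in> K_set \<eta> r" "k \<in> {1..r}" "\<eta> k > 0" "pos s = block_start \<eta> k" "j \<noteq> s"
  shows "M $ s $ j = 0"
proof -
  obtain B where M: "M = block_diag \<eta> r B" and B: "\<And>k. k \<in> {1..r} \<Longrightarrow> B k \<in> T_set (\<eta> k)"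
    using assms by (auto simp: K_set_def)
  have k: "pos s \<in> {block_start \<eta> k..<block_start \<eta> k + \<eta> k}"
    using assms by auto
  have "pos s \<noteq> pos j" using assms(5) pos_inject by metis
  then show ?thesis
    using B[OF assms(2)] k assms(4) unfolding M block_diag_nth[OF assms(2) k] T_set_def by auto
qed

text \<open>With \<open>K_set_first_row\<close>, every diagonal entry becomes the eigenvalue of the
  first coordinate functional of its block.\<close>

lemma K_set_diagonal:
  fixes M :: "complex ^ 'n::{finite,linorder} ^ 'n::{finite,linorder}"
  assumes "M \<in> K_set \<eta> r" "k \<in> {1..r}" "pos s = block_start \<eta> k"
    and j: "pos j \<in> {block_start \<eta> k..<block_start \<eta> k + \<eta> k}"
  shows "M $ j $ j = M $ s $ s"
proof -
  obtain B where M: "M = block_diag \<eta> r B" and B: "\<And>k. k \<in> {1..r} \<Longrightarrow> B k \<in> T_set (\<eta> k)"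
    using assms by (auto simp: K_set_def)
  have s: "pos s \<in> {block_start \<eta> k..<block_start \<eta> k + \<eta> k}"
    using assms by auto
  define a where "a = pos j - block_start \<eta> k"
  have "a < \<eta> k" "0 < \<eta> k" using j by (auto simp: a_def)
  then have "B k a a = B k 0 0"
    using B[OF assms(2)] unfolding T_set_def by blast
  then show ?thesis
    unfolding M block_diag_nth[OF assms(2) s] block_diag_nth[OF assms(2) j]
    using s j assms(3) by (simp add: a_def)
qed

section \<open>Common eigenvectors among row vectors\<close>

text \<open>Row vectors as complex linear functionals: no conjugation, and complex values, unlike
  the real inner product on this type.\<close>

definition row_apply :: "complex ^ 'n \<Rightarrow> complex ^ 'n \<Rightarrow> complex" where
  "row_apply \<phi> x = (\<Sum>i\<in>UNIV. \<phi> $ i * x $ i)"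

lemma row_apply_vector_matrix_mult: "row_apply (\<phi> v* M) x = row_apply \<phi> (M *v x)"
  unfolding row_apply_def vector_matrix_mult_def matrix_vector_mult_def
  by (simp add: sum_distrib_left sum_distrib_right mult_ac) (rule sum.swap)

lemma row_apply_diff_left: "row_apply (\<phi> - \<psi>) x = row_apply \<phi> x - row_apply \<psi> x"
  by (simp add: row_apply_def left_diff_distrib sum_subtractf)

lemma row_apply_scale_left: "row_apply (c *s \<phi>) x = c * row_apply \<phi> x"
  by (simp add: row_apply_def sum_distrib_left mult_ac)

text \<open>Some linear \<open>g\<close> kills a basis of \<open>W\<close> and fixes a vector
  \<open>u\<close> outside \<open>W\<close>. The row of its matrix at an index where
  \<open>u\<close> is nonzero is the annihilator.\<close>

lemma ex_annihilating_row:
  fixes W :: "(complex ^ 'n) set"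
  assumes "vec.subspace W" "W \<noteq> UNIV"
  shows "\<exists>\<phi>. \<phi> \<noteq> 0 \<and> (\<forall>w\<in>W. row_apply \<phi> w = 0)"
proof -
  obtain u where u: "u \<notin> W" using assms by auto
  obtain B where B: "B \<subseteq> W" "vec.independent B" "W \<subseteq> vec.span B"
    using vec.maximal_independent_subset by blast
  have "vec.span B = W"
    using B assms by (simp add: vec.span_minimal subset_antisym)
  then have "vec.independent (insert u B)"
    using u B vec.independent_insertI by blast
  then obtain g :: "complex ^ 'n \<Rightarrow> complex ^ 'n"
    where g: "Vector_Spaces.linear (*s) (*s) g" "\<And>x. x \<in> insert u B \<Longrightarrow> g x = (if x = u then u else 0)"
    using vec.linear_independent_extend[of "insert u B" "\<lambda>x. if x = u then u else 0"] by blast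
  have g0: "g w = 0" if "w \<in> W" for w
  proof (rule vec.linear_eq_0_on_span[OF g(1)])
    show "w \<in> vec.span B" using that B by auto
  qed (use g u B in auto)
  have "u \<noteq> 0" using u assms vec.subspace_0 by blast
  then obtain i where i: "u $ i \<noteq> 0" by (auto simp: vec_eq_iff)
  have row: "row_apply (matrix g $ i) x = g x $ i" for x
    using matrix_works[OF g(1), of x]
    by (auto simp: row_apply_def matrix_vector_mult_def vec_eq_iff)
  have "row_apply (matrix g $ i) u \<noteq> 0"
    using g(2)[of u] i row by simp
  then have "matrix g $ i \<noteq> 0" by (auto simp: row_apply_def)
  then show ?thesis using row g0 by auto
qed

text \<open>The annihilator of \<open>W\<close> is stable under right multiplication by
  \<open>S\<close>. A lower triangular \<open>M\<close> never moves the last nonzero position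
  \<open>j\<close> of a row to the right, and it multiplies that entry by \<open>M $ j $ j\<close>.
  So \<open>\<phi> v* M - M $ j $ j *s \<phi>\<close> annihilates \<open>W\<close> and is supported
  strictly before \<open>j\<close>; for minimal \<open>j\<close> it must vanish. The choice of
  \<open>\<phi>\<close> is independent of \<open>M\<close>, so one row serves all of
  \<open>S\<close>.\<close>

lemma ex_triangular_eigenrow:
  fixes S :: "(complex ^ 'n::{finite,linorder} ^ 'n::{finite,linorder}) set"
  assumes tri: "\<And>M i j. M \<in> S \<Longrightarrow> i < j \<Longrightarrow> M $ i $ j = 0"
    and W: "vec.subspace W" "W \<noteq> UNIV" "\<And>M w. M \<in> S \<Longrightarrow> w \<in> W \<Longrightarrow> M *v w \<in> W"
  shows "\<exists>\<phi> j. \<phi> \<noteq> 0 \<and> (\<forall>w\<in>W. row_apply \<phi> w = 0) \<and> (\<forall>M\<in>S. \<phi> v* M = M $ j $ j *s \<phi>)"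
proof -
  define Ann where "Ann = {\<phi>. \<phi> \<noteq> 0 \<and> (\<forall>w\<in>W. row_apply \<phi> w = 0)}"
  \<comment> \<open>For the zero row this is the maximum of the empty set; its properties are
    claimed for nonzero rows only.\<close>
  define top where "top \<phi> = Max {i. \<phi> $ i \<noteq> 0}" for \<phi> :: "complex ^ 'n::{finite,linorder}"
  have top: "\<phi> $ top \<phi> \<noteq> 0" "\<And>i. \<phi> $ i \<noteq> 0 \<Longrightarrow> i \<le> top \<phi>" if "\<phi> \<noteq> 0" for \<phi>
  proof -
    have "{i. \<phi> $ i \<noteq> 0} \<noteq> {}" using that by (auto simp: vec_eq_iff)
    then show "\<phi> $ top \<phi> \<noteq> 0" using Max_in[of "{i. \<phi> $ i \<noteq> 0}"] by (auto simp: top_def)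
    show "i \<le> top \<phi>" if "\<phi> $ i \<noteq> 0" for i
      using that unfolding top_def by (intro Max_ge) auto
  qed
  obtain \<phi>0 where "\<phi>0 \<in> Ann" using ex_annihilating_row[OF W(1,2)] by (auto simp: Ann_def)
  then obtain \<phi> where \<phi>: "\<phi> \<in> Ann" "\<And>\<psi>. \<psi> \<in> Ann \<Longrightarrow> pos (top \<phi>) \<le> pos (top \<psi>)"
    using ex_has_least_nat[of "\<lambda>\<phi>. \<phi> \<in> Ann" \<phi>0 "\<lambda>\<phi>. pos (top \<phi>)"] by blast
  define j where "j = top \<phi>"
  have j: "\<phi> $ i = 0" if "j < i" for i
    using top(2)[of \<phi> i] \<phi>(1) that by (fastforce simp: Ann_def j_def)
  have "\<phi> v* M = M $ j $ j *s \<phi>" if M: "M \<in> S" for M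
  proof (rule ccontr)
    define \<psi> where "\<psi> = \<phi> v* M - M $ j $ j *s \<phi>"
    assume "\<not> ?thesis"
    then have "\<psi> \<noteq> 0" by (simp add: \<psi>_def)
    moreover have "row_apply \<psi> w = 0" if "w \<in> W" for w
      using \<phi>(1) W(3)[OF M that] that
      by (simp add: \<psi>_def Ann_def row_apply_diff_left row_apply_scale_left
          row_apply_vector_matrix_mult)
    ultimately have "\<psi> \<in> Ann" by (simp add: Ann_def)
    have "\<psi> $ i = 0" if "j \<le> i" for i
    proof -
      \<comment> \<open>If \<open>l < i\<close>, triangularity applies; otherwise
        \<open>l \<ge> i \<ge> j\<close> with \<open>l \<noteq> j\<close>, and \<open>\<phi>\<close>
        vanishes beyond \<open>j\<close>.\<close>
      have "\<phi> $ l * M $ l $ i = 0" if "l \<noteq> j \<or> i \<noteq> j" for l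
        using j tri[OF M, of l i] \<open>j \<le> i\<close> that by (cases "l < i") (auto simp: not_less)
      then have "(\<Sum>l\<in>UNIV. \<phi> $ l * M $ l $ i)
          = (\<Sum>l\<in>UNIV. if l = j then \<phi> $ j * M $ j $ i else 0)"
        by (intro sum.cong) auto
      then have "(\<phi> v* M) $ i = \<phi> $ j * M $ j $ i"
        by (simp add: vector_matrix_mult_def mult.commute)
      then show ?thesis
        using tri[OF M, of j i] j[of i] \<open>j \<le> i\<close> by (cases "i = j") (auto simp: \<psi>_def)
    qed
    then have "top \<psi> < j"
      using top(1)[OF \<open>\<psi> \<noteq> 0\<close>] by (meson not_less)
    then show False
      using \<phi>(2)[OF \<open>\<psi> \<in> Ann\<close>] by (simp add: j_def flip: pos_less_iff)
  qed
  then show ?thesis using \<phi>(1) unfolding Ann_def by blast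
qed

section \<open>Cyclic vectors of commuting families\<close>

lemma tendsto_matrix_vector_mult:
  fixes M :: "complex ^ 'n ^ 'm"
  assumes "X \<longlonglongrightarrow> x"
  shows "(\<lambda>m. M *v X m) \<longlonglongrightarrow> M *v x"
  unfolding matrix_vector_mult_def by (intro tendsto_intros assms)

text \<open>\<open>bilinear\<close> and \<open>bounded_bilinear\<close> speak of real scalars, so
  complex linearity has to be restricted to them.\<close>

lemma linear_vector_scalar_mult:
  "Vector_Spaces.linear (*s) (*s) (f :: complex ^ 'n \<Rightarrow> complex ^ 'm) \<Longrightarrow> linear f"
proof (rule linearI)
  assume f: "Vector_Spaces.linear (*s) (*s) f"
  show "f (x + y) = f x + f y" for x y by (rule vec.linear_add[OF f])
  have "c *\<^sub>R x = complex_of_real c *s x" for c :: real and x :: "complex ^ 'k"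
    by (simp only: vec_eq_iff vector_scaleR_component) (simp add: scaleR_conv_of_real)
  then show "f (c *\<^sub>R x) = c *\<^sub>R f x" for c x
    using vec.linear_scale[OF f] by metis
qed

text \<open>Pick a basis of the whole space inside the orbit of \<open>x\<close>, each
  \<open>b\<close> being \<open>g b *v x\<close>. Expanding \<open>z\<close> in it and replacing
  each \<open>b\<close> by \<open>g b\<close> gives \<open>\<Phi> z\<close>, a combination of
  elements of \<open>G\<close>; it sends \<open>x\<close> to \<open>z\<close> and commutes with
  \<open>G\<close>.\<close>

lemma cyclic_vector_bilinear:
  fixes G :: "(complex ^ 'n ^ 'n) set"
  assumes comm: "\<And>M N. M \<in> G \<Longrightarrow> N \<in> G \<Longrightarrow> M ** N = N ** M"
    and span: "vec.span ((\<lambda>M. M *v x) ` G) = UNIV"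
  shows "\<exists>\<Phi> :: complex ^ 'n \<Rightarrow> complex ^ 'n \<Rightarrow> complex ^ 'n. bounded_bilinear \<Phi> \<and>
    (\<forall>z. \<Phi> z x = z) \<and> (\<forall>w. \<Phi> x w = w) \<and> (\<forall>M\<in>G. \<forall>z w. M *v \<Phi> z w = \<Phi> z (M *v w))"
proof -
  obtain B where B: "B \<subseteq> (\<lambda>M. M *v x) ` G" "vec.independent B" "(\<lambda>M. M *v x) ` G \<subseteq> vec.span B"
    using vec.maximal_independent_subset by blast
  have spanB: "vec.span B = UNIV"
    using B(3) span by (metis UNIV_I subsetI subset_antisym vec.span_minimal vec.subspace_span)
  have finB: "finite B" using B(2) by (rule vec.finiteI_independent)
  have "\<forall>b\<in>B. \<exists>M\<in>G. b = M *v x" using B(1) by blast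
  then obtain g where g: "\<And>b. b \<in> B \<Longrightarrow> g b \<in> G" "\<And>b. b \<in> B \<Longrightarrow> g b *v x = b"
    by metis
  define \<Phi> where "\<Phi> z w = (\<Sum>b\<in>B. vec.representation B z b *s (g b *v w))" for z w
  have lin1: "Vector_Spaces.linear (*s) (*s) (\<Phi> z)" for z
    unfolding \<Phi>_def
    by (intro vec.linear_compose_sum ballI vec.linear_compose_scale_right matrix_vector_mul_linear_gen)
  have lin2: "Vector_Spaces.linear (*s) (*s) (\<lambda>z. \<Phi> z w)" for w
    unfolding \<Phi>_def
    by (intro vec.linear_compose_sum ballI vec.linear_compose_scale vec.linear_representation B(2) spanB)
  have "bilinear \<Phi>"
    unfolding bilinear_def using lin1 lin2 linear_vector_scalar_mult by blast
  then have 1: "bounded_bilinear \<Phi>"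
    by (simp add: bilinear_conv_bounded_bilinear)
  have 2: "\<Phi> z x = z" for z
    unfolding \<Phi>_def using g(2)
      vec.sum_representation_eq[OF B(2) _ finB order.refl, of z] by (simp add: spanB)
  have 3: "M *v \<Phi> z w = \<Phi> z (M *v w)" if "M \<in> G" for M z w
  proof -
    have "M *v (g b *v w) = g b *v (M *v w)" if "b \<in> B" for b
      using comm[OF \<open>M \<in> G\<close> g(1)[OF that]] by (simp add: matrix_vector_mul_assoc)
    then show ?thesis
      by (simp add: \<Phi>_def vec.linear_sum[OF matrix_vector_mul_linear_gen]
          vector_scalar_commute)
  qed
  \<comment> \<open>\<open>\<Phi> x\<close> fixes \<open>x\<close> and commutes with
    \<open>G\<close>, so it fixes the orbit of \<open>x\<close>, which spans.\<close>
  have 4: "\<Phi> x w = w" for w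
  proof (rule vec.linear_eq_on[OF lin1 vec.linear_ident, where B = "(\<lambda>M. M *v x) ` G"])
    show "w \<in> vec.span ((\<lambda>M. M *v x) ` G)" by (simp add: span)
    show "\<Phi> x b = b" if b: "b \<in> (\<lambda>M. M *v x) ` G" for b
      using that 2 3 by (metis (no_types, lifting) imageE)
  qed
  show ?thesis using 1 2 3 4 by (intro exI[of _ \<Phi>]) simp
qed

text \<open>With \<open>u m = M m *v x\<close>, the error \<open>u m - M m *v X m\<close> equals
  \<open>\<Phi> (x - X m) (u m)\<close>, which is small relative to \<open>u m\<close>.\<close>

lemma tendsto_orbit_of_cyclic_vector:
  fixes G :: "(complex ^ 'n ^ 'n) set"
  assumes comm: "\<And>M N. M \<in> G \<Longrightarrow> N \<in> G \<Longrightarrow> M ** N = N ** M"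
    and span: "vec.span ((\<lambda>M. M *v x) ` G) = UNIV"
    and M: "\<And>m. M m \<in> G" and X: "X \<longlonglongrightarrow> x" and y: "(\<lambda>m. M m *v X m) \<longlonglongrightarrow> y"
  shows "(\<lambda>m. M m *v x) \<longlonglongrightarrow> y"
proof -
  obtain \<Phi> :: "complex ^ 'n \<Rightarrow> complex ^ 'n \<Rightarrow> complex ^ 'n"
  where \<Phi>: "bounded_bilinear \<Phi>" "\<And>z. \<Phi> z x = z" "\<And>w. \<Phi> x w = w"
    "\<And>M z w. M \<in> G \<Longrightarrow> M *v \<Phi> z w = \<Phi> z (M *v w)"
    using cyclic_vector_bilinear[of G, OF comm span] by metis
  obtain K where K: "K > 0" "\<And>a b. norm (\<Phi> a b) \<le> norm a * norm b * K"
    using bounded_bilinear.pos_bounded[OF \<Phi>(1)] by blast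
  define u where "u m = M m *v x" for m
  have \<Phi>u: "\<Phi> (X m) (u m) = M m *v X m" for m
    using \<Phi>(4)[OF M, of m "X m" x] by (simp add: \<Phi>(2) u_def)
  have near: "norm (u m - M m *v X m) \<le> K * norm (x - X m) * norm (u m)" for m
  proof -
    have "u m - M m *v X m = \<Phi> (x - X m) (u m)"
      by (simp add: bounded_bilinear.diff_left[OF \<Phi>(1)] \<Phi>(3) \<Phi>u)
    then show ?thesis using K(2)[of "x - X m" "u m"] by (simp add: mult_ac)
  qed
  have lim0: "(\<lambda>m. K * norm (x - X m)) \<longlonglongrightarrow> 0"
    using X by (auto intro!: tendsto_eq_intros)
  \<comment> \<open>Once the factor is below 1/2, the error is absorbed into
    \<open>norm (u m)\<close>. This bounds \<open>u m\<close> by twice a convergent sequence before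
    its own convergence is known.\<close>
  then have "\<forall>\<^sub>F m in sequentially. K * norm (x - X m) < 1 / 2"
    by (rule order_tendstoD) simp
  then have small: "\<forall>\<^sub>F m in sequentially.
      norm (u m - M m *v X m) \<le> K * norm (x - X m) * (2 * norm (M m *v X m))"
  proof eventually_elim
    case (elim m)
    have "K * norm (x - X m) * norm (u m) \<le> 1 / 2 * norm (u m)"
      using elim by (intro mult_right_mono) auto
    then have "norm (u m) \<le> 2 * norm (M m *v X m)"
      using near[of m] norm_triangle_ineq2[of "u m" "M m *v X m"] by linarith
    then have "K * norm (x - X m) * norm (u m) \<le> K * norm (x - X m) * (2 * norm (M m *v X m))"
      using K(1) by (intro mult_left_mono) auto
    then show ?case using near[of m] by linarith
  qed
  have "(\<lambda>m. K * norm (x - X m) * (2 * norm (M m *v X m))) \<longlonglongrightarrow> 0 * (2 * norm y)"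
    by (rule tendsto_mult[OF lim0 tendsto_mult[OF tendsto_const tendsto_norm[OF y]]])
  then have "(\<lambda>m. K * norm (x - X m) * (2 * norm (M m *v X m))) \<longlonglongrightarrow> 0" by simp
  with small have "(\<lambda>m. u m - M m *v X m) \<longlonglongrightarrow> 0"
    by (rule Lim_null_comparison)
  from tendsto_add[OF this y] show ?thesis by (simp add: u_def[symmetric])
qed

section \<open>Hyperplanes containing the locally hypercyclic points\<close>

text \<open>\<open>P\<close> carries the hyperplane \<open>{x. x $ s = 0}\<close> injectively onto
  this one.\<close>

lemma dim_coordinate_hyperplane:
  fixes P Q :: "complex ^ 'n ^ 'n"
  assumes "P ** Q = mat 1" "Q ** P = mat 1"
  shows "vec.subspace {x. (Q *v x) $ s = 0}" "vec.dim {x. (Q *v x) $ s = 0} = CARD('n) - 1"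
proof -
  show "vec.subspace {x. (Q *v x) $ s = 0}"
    by (auto simp: vec.subspace_def matrix_vector_right_distrib vector_scalar_commute)
  have PQ: "P *v (Q *v x) = x" "Q *v (P *v x) = x" for x
    using assms by (simp_all add: matrix_vector_mul_assoc)
  have "{x. (Q *v x) $ s = 0} = (*v) P ` {x. x $ s = 0}"
    using PQ by (force simp: image_iff)
  moreover have "inj ((*v) P)" by (metis PQ(2) injI)
  ultimately have "vec.dim {x. (Q *v x) $ s = 0} = vec.dim {x :: complex ^ 'n. x $ s = 0}"
    by (simp add: vec.dim_image_eq inj_on_subset)
  also have "{x :: complex ^ 'n. x $ s = 0} = {x. \<forall>i. i \<notin> UNIV - {s} \<longrightarrow> x $ i = 0}" by auto
  also have "vec.dim \<dots> = CARD('n) - 1"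
    unfolding dim_substandard_cart by (simp add: card_Diff_singleton)
  finally show "vec.dim {x. (Q *v x) $ s = 0} = CARD('n) - 1" .
qed

text \<open>As the eigenvalues are shared,
  \<open>c m * row_apply \<psi> (X m) * row_apply \<phi> (X m)\<close> has two expressions for its
  limit, one of which contains the factor \<open>row_apply \<phi> x = 0\<close>.\<close>

lemma eigenrow_vanishes_on_limit:
  fixes \<phi> \<psi> :: "complex ^ 'n"
  assumes M: "\<And>m. \<phi> v* M m = c m *s \<phi>" "\<And>m. \<psi> v* M m = c m *s \<psi>"
    and "row_apply \<psi> x \<noteq> 0" "row_apply \<phi> x = 0"
    and X: "X \<longlonglongrightarrow> x" "(\<lambda>m. M m *v X m) \<longlonglongrightarrow> y"
  shows "row_apply \<phi> y = 0"
proof -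
  have lim: "(\<lambda>m. row_apply \<rho> (Z m)) \<longlonglongrightarrow> row_apply \<rho> z" if "Z \<longlonglongrightarrow> z"
    for \<rho> z and Z :: "nat \<Rightarrow> complex ^ 'n"
    unfolding row_apply_def by (intro tendsto_intros that)
  have "row_apply \<rho> (M m *v X m) = c m * row_apply \<rho> (X m)" if "\<rho> \<in> {\<phi>, \<psi>}" for \<rho> m
    using that M by (auto simp flip: row_apply_vector_matrix_mult simp: row_apply_scale_left)
  then have e: "(\<lambda>m. c m * row_apply \<rho> (X m)) \<longlonglongrightarrow> row_apply \<rho> y" if "\<rho> \<in> {\<phi>, \<psi>}" for \<rho>
    using lim[OF X(2), of \<rho>] that by simp
  txt \<open>Eliminating \<open>c m\<close> crosswise avoids dividing by the values of \<open>\<psi>\<close>.\<close>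
  have "(\<lambda>m. c m * row_apply \<psi> (X m) * row_apply \<phi> (X m)) \<longlonglongrightarrow> row_apply \<psi> y * row_apply \<phi> x"
    by (rule tendsto_mult[OF e lim[OF X(1)]]) simp
  moreover have "(\<lambda>m. c m * row_apply \<phi> (X m) * row_apply \<psi> (X m)) \<longlonglongrightarrow> row_apply \<phi> y * row_apply \<psi> x"
    by (rule tendsto_mult[OF e lim[OF X(1)]]) simp
  ultimately have "row_apply \<psi> y * row_apply \<phi> x = row_apply \<phi> y * row_apply \<psi> x"
    by (intro LIMSEQ_unique) (auto simp: mult_ac)
  then show ?thesis using assms by simp
qed

theorem corollary1p4:
  fixes A :: "nat \<Rightarrow> complex ^ 'n::{finite,linorder} ^ 'n::{finite,linorder}"
    and P :: "complex ^ 'n::{finite,linorder} ^ 'n::{finite,linorder}"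
    and p r :: nat and \<eta> :: "nat \<Rightarrow> nat"
    and G :: "(complex ^ 'n::{finite,linorder} ^ 'n::{finite,linorder}) set"
  assumes "p \<ge> 1"
    and "\<forall>i\<in>{1..p}. \<forall>j\<in>{1..p}. A i ** A j = A j ** A i"
    and "G = gen_semigroup p A"
    and "invertible P"
    and "r \<in> {1..CARD('n)}"
    and "\<forall>k\<in>{1..r}. \<eta> k > 0"
    and "(\<Sum>k=1..r. \<eta> k) = CARD('n)"
    and "(\<lambda>M. matrix_inv P ** M ** P) ` G \<subseteq> K_set \<eta> r"
    and "\<not> hypercyclic G"
  shows "\<exists>H :: nat \<Rightarrow> (complex ^ 'n::{finite,linorder}) set.
           (\<forall>k\<in>{1..r}. vec.subspace (H k) \<and> vec.dim (H k) = CARD('n) - 1 \<and>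
                       invariant_under G (H k)) \<and>
           {x. ext_limit_set p A x = UNIV} \<subseteq> (\<Union>k\<in>{1..r}. H k)"
proof -

  \<comment> \<open>Coordinates given by \<open>P\<close>, and the invariant hyperplanes\<close>
  define Q where "Q = matrix_inv P"
  have PQ: "P ** Q = mat 1" "Q ** P = mat 1"
    using someI_ex[OF assms(4)[unfolded invertible_def]] by (simp_all add: Q_def matrix_inv_def)
  define S where "S = (\<lambda>M. Q ** M ** P) ` G"
  have S: "S \<subseteq> K_set \<eta> r" using assms(8) by (simp add: S_def Q_def)
  have conj: "Q *v (M *v v) = (Q ** M ** P) *v (Q *v v)" for M v
    by (metis PQ(1) matrix_mul_assoc matrix_mul_rid matrix_vector_mul_assoc)
  have comm: "M ** N = N ** M" if "M \<in> G" "N \<in> G" for M N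
    using gen_semigroup_commute[OF assms(2)] that assms(3) by blast
  \<comment> \<open>The index of the top row of block \<open>k\<close> exists because the block is
    nonempty and ends within the matrix.\<close>
  have "\<exists>s :: 'n. pos s = block_start \<eta> k" if k: "k \<in> {1..r}" for k
  proof -
    have "block_start \<eta> k + \<eta> k \<le> (\<Sum>k=1..r. \<eta> k)"
      using block_start_add_le[of k "Suc r" \<eta>] k
      by (simp add: block_start_def atLeastLessThanSuc_atLeastAtMost)
    then have "block_start \<eta> k < CARD('n)"
      using assms(6,7) k by fastforce
    then show ?thesis using range_pos by (metis imageE lessThan_iff)
  qed
  then obtain s :: "nat \<Rightarrow> 'n" where s: "\<And>k. k \<in> {1..r} \<Longrightarrow> pos (s k) = block_start \<eta> k"
    by metis
  define H where "H k = {x. (Q *v x) $ s k = 0}" for k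
  have eig: "axis (s k) 1 v* N = N $ s k $ s k *s axis (s k) 1" if "N \<in> S" "k \<in> {1..r}" for N k
  proof -
    have "(axis (s k) 1 v* N) $ j = N $ s k $ j" for j
      by (simp add: vector_matrix_mult_def axis_def if_distrib if_distribR cong: if_cong)
    moreover have "N $ s k $ j = 0" if "j \<noteq> s k" for j
    proof (rule K_set_first_row)
      show "N \<in> K_set \<eta> r" using S \<open>N \<in> S\<close> by blast
      show "\<eta> k > 0" using assms(6) \<open>k \<in> {1..r}\<close> by blast
    qed (fact \<open>k \<in> {1..r}\<close> s[OF \<open>k \<in> {1..r}\<close>] that)+
    ultimately show ?thesis by (auto simp: vec_eq_iff axis_def)
  qed
  have coord: "row_apply (axis i 1) v = v $ i" for i :: 'n and v
    by (simp add: row_apply_def axis_def if_distrib if_distribR cong: if_cong)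
  have "invariant_under G (H k)" if k: "k \<in> {1..r}" for k
  proof -
    \<comment> \<open>The functional defining \<open>H k\<close> is only scaled by its eigenvalue,
      so its kernel is preserved.\<close>
    have "M *v v \<in> H k" if "M \<in> G" "v \<in> H k" for M v
    proof -
      let ?N = "Q ** M ** P"
      have "?N \<in> S" using that by (auto simp: S_def)
      have "(Q *v (M *v v)) $ s k = row_apply (axis (s k) 1 v* ?N) (Q *v v)"
        by (simp add: conj coord row_apply_vector_matrix_mult)
      then show ?thesis
        using that by (simp add: eig[OF \<open>?N \<in> S\<close> k] row_apply_scale_left coord H_def)
    qed
    then show ?thesis by (auto simp: invariant_under_def)
  qed

  \<comment> \<open>Contradiction for a point of E off all hyperplanes\<close>
  moreover have "x \<in> (\<Union>k\<in>{1..r}. H k)" if x: "ext_limit_set p A x = UNIV" for x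
  proof (rule ccontr)
    assume notin: "x \<notin> (\<Union>k\<in>{1..r}. H k)"
    have J: "\<exists>X M. (\<forall>m. M m \<in> G) \<and> X \<longlonglongrightarrow> x \<and> (\<lambda>m. M m *v X m) \<longlonglongrightarrow> y" for y
    proof -
      have "y \<in> ext_limit_set p A x" using x by simp
      then obtain X k where "X \<longlonglongrightarrow> x" "(\<lambda>m. mat_monomial p A (k m) *v X m) \<longlonglongrightarrow> y"
        unfolding ext_limit_set_def by blast
      moreover have "mat_monomial p A (k m) \<in> G" for m
        using assms(3) by (auto simp: gen_semigroup_def)
      ultimately show ?thesis by (intro exI[of _ X] exI[of _ "\<lambda>m. mat_monomial p A (k m)"]) auto
    qed
    define W where "W = vec.span ((\<lambda>M. M *v x) ` G)"
    have Gmul: "M *v w \<in> W" if "M \<in> G" "w \<in> W" for M w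
      using that(2) unfolding W_def
    proof (induction rule: vec.span_induct_alt)
      case base
      show ?case by (simp add: vec.span_zero)
    next
      case (step c y z)
      then obtain N where N: "N \<in> G" "y = N *v x" by blast
      have "M ** N \<in> G" using gen_semigroup_mult[OF assms(2)] assms(3) that(1) N(1) by blast
      then have "M *v y \<in> vec.span ((\<lambda>M. M *v x) ` G)"
        unfolding N(2) matrix_vector_mul_assoc by (intro vec.span_base) auto
      then show ?case
        using step by (simp add: matrix_vector_right_distrib vec.span_add vec.span_scale
            vector_scalar_commute)
    qed
    \<comment> \<open>The identity is the monomial with all exponents zero, so \<open>x\<close> lies
      in its own orbit.\<close>
    have xW: "x \<in> W"
      using mat_1_in_gen_semigroup[of p A] assms(3) unfolding W_def
      by (intro vec.span_base) (force simp: image_iff)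
    \<comment> \<open>\<open>W\<close> seen in the coordinates in which the semigroup is
      triangular.\<close>
    define V where "V = {v. P *v v \<in> W}"
    have V: "vec.subspace V"
      unfolding V_def W_def vec.subspace_def
      by (auto simp: matrix_vector_right_distrib vec.span_zero vec.span_add vec.span_scale
            vector_scalar_commute)
    have QxV: "Q *v x \<in> V"
      using xW by (simp add: V_def matrix_vector_mul_assoc PQ)
    have VN: "N *v v \<in> V" if N: "N \<in> S" and v: "v \<in> V" for N v
    proof -
      obtain M where M: "M \<in> G" "N = Q ** M ** P" using N by (auto simp: S_def)
      have "P ** N = M ** P" by (simp add: M(2) matrix_mul_assoc PQ)
      then have "P *v (N *v v) = M *v (P *v v)" by (simp add: matrix_vector_mul_assoc)
      then show ?thesis using Gmul M(1) v by (simp add: V_def)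
    qed
    show False
    proof (cases "V = UNIV")
      case False
      obtain \<phi> j where \<phi>: "\<phi> \<noteq> 0" "\<And>w. w \<in> V \<Longrightarrow> row_apply \<phi> w = 0"
        and \<phi>N: "\<And>N. N \<in> S \<Longrightarrow> \<phi> v* N = N $ j $ j *s \<phi>"
        using ex_triangular_eigenrow[of S V] S K_set_lower_triangular[OF _ assms(7)] V VN False
        by (metis subsetD)
      \<comment> \<open>The eigenvalues of \<open>\<phi>\<close> are the diagonal entries at
        \<open>j\<close>; the block containing \<open>j\<close> supplies \<open>axis (s k) 1\<close>
        with the same eigenvalues, nonzero at \<open>Q *v x\<close> since \<open>x\<close> avoids
        \<open>H k\<close>.\<close>
      obtain k where k: "k \<in> {1..r}" "pos j \<in> {block_start \<eta> k..<block_start \<eta> k + \<eta> k}"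
        using ex_block[of "pos j" \<eta> r] assms(7) pos_less_card[of j] by auto
      have "row_apply \<phi> y = 0" for y
      proof -
        \<comment> \<open>The target \<open>P *v y\<close> becomes \<open>y\<close> after applying
          \<open>Q\<close>; as \<open>y\<close> is arbitrary, \<open>\<phi>\<close> vanishes
          everywhere.\<close>
        obtain X M where M: "\<And>m. M m \<in> G" and X: "X \<longlonglongrightarrow> x" "(\<lambda>m. M m *v X m) \<longlonglongrightarrow> P *v y"
          using J[of "P *v y"] by blast
        define N where "N m = Q ** M m ** P" for m
        have N: "N m \<in> S" for m using M by (auto simp: N_def S_def)
        have lim: "(\<lambda>m. N m *v (Q *v X m)) \<longlonglongrightarrow> y"
          using tendsto_matrix_vector_mult[OF X(2), of Q]
          unfolding conj N_def[symmetric] by (simp add: matrix_vector_mul_assoc PQ)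
        have QX: "(\<lambda>m. Q *v X m) \<longlonglongrightarrow> Q *v x"
          by (rule tendsto_matrix_vector_mult[OF X(1)])
        have row: "axis (s k) 1 v* N m = N m $ j $ j *s axis (s k) 1" for m
          unfolding K_set_diagonal[OF subsetD[OF S N] k(1) s[OF k(1)] k(2)] by (rule eig[OF N k(1)])
        have nz: "row_apply (axis (s k) 1) (Q *v x) \<noteq> 0"
          using notin k(1) by (auto simp: H_def coord)
        show ?thesis
          by (rule eigenrow_vanishes_on_limit[OF \<phi>N[OF N] row nz \<phi>(2)[OF QxV] QX lim])
      qed
      moreover have "row_apply \<phi> (axis i 1) = \<phi> $ i" for i
        by (simp add: row_apply_def axis_def if_distrib cong: if_cong)
      ultimately show False using \<phi>(1) by (simp add: vec_eq_iff)
    next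
      case True
      have "v \<in> W" for v
      proof -
        have "Q *v v \<in> V" using True by simp
        then show ?thesis by (simp add: V_def matrix_vector_mul_assoc PQ)
      qed
      then have W: "vec.span ((\<lambda>M. M *v x) ` G) = UNIV" by (auto simp: W_def)
      have "y \<in> closure (orbit G x)" for y
      proof -
        obtain X M where M: "\<And>m. M m \<in> G" and X: "X \<longlonglongrightarrow> x" "(\<lambda>m. M m *v X m) \<longlonglongrightarrow> y"
          using J[of y] by blast
        \<comment> \<open>The moving points \<open>X m\<close> are replaced by the fixed vector
          \<open>x\<close>, turning an extended limit into a limit of orbit points.\<close>
        have "(\<lambda>m. M m *v x) \<longlonglongrightarrow> y"
          using comm W M X by (rule tendsto_orbit_of_cyclic_vector)
        moreover have "M m *v x \<in> orbit G x" for m using M by (auto simp: orbit_def)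
        ultimately show ?thesis
          unfolding closure_sequential by (intro exI[of _ "\<lambda>m. M m *v x"]) simp
      qed
      then have "closure (orbit G x) = UNIV" by blast
      then show False using assms(9) by (auto simp: hypercyclic_def)
    qed
  qed
  ultimately show ?thesis
    using dim_coordinate_hyperplane[OF PQ] by (intro exI[of _ H]) (auto simp: H_def)
qed

end
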